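(* Consider human ratings generated by a rating model $h$ of degree $q\ge 2$ as described in the context, with noise level $\sigma$, reward bound $R$ and variance bound $V_{R,\sigma}^2$. For any fixed constant $0<\delta<1$, there exists a contextual bandit instance with initial state distribution $\rho$ such that if one samples a dataset $\mathcal D$ of size $n\ge c(\delta,c_b,c_V,q,\sigma,R)$ using a sampling distribution $d$ satisfying the partial coverage assumption (there exists an optimal policy $\pi^\star$ such that $d(s,a)>0$ whenever $d^{\pi^\star}_\rho(s,a)>0$, for any $(s,a)\in\mathcal S\times\mathcal A$) with $C^\star:=\max_{(s,a):\,d(s,a)>0} d_\rho^{\pi^\star}(s,a)/d(s,a)=2$, and runs the LCB algorithm with penalty $b_m=c_b\sqrt{\widetilde V_{R,\sigma}^2\log(SA/\delta)/m}$ on $\mathcal D$, the output policy $\widehat\pi_{\rm LCB}$ must suffer constant suboptimality, i.e., $$\mathbb E_{\mathcal D}\big[\mathrm{SubOpt}(\widehat\pi_{\rm LCB})\big]\ \ge\ c_0R ,$$ where $c_0>0$ is a universal constant and $c(\delta,c_b,c_V,q,\sigma,R)$ is a constant depending on $\delta,c_b,c_V,q,\sigma,R$.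
   Context: Contextual bandit: $(\mathcal S,\mathcal A,r,\rho)$ with $\mathcal S=\{1,\dots,S\}$, $\mathcal A=\{1,\dots,A\}$, unknown deterministic reward $r:\mathcal S\times\mathcal A\to[0,R]$, and initial state distribution $\rho$. A policy is $\pi:\mathcal S\to\Delta(\mathcal A)$; $d^\pi_\rho(s,a)=\rho(s)\pi(a|s)$ is its state-action visitation distribution; $\pi^\star$ denotes an optimal policy (maximizing $\mathbb E_{a\sim\pi(\cdot|s)}[r(s,a)]$ for all $s$ simultaneously). $\mathrm{SubOpt}(\pi)=\mathbb E_{s\sim\rho}\big[\mathbb E_{a\sim\pi^\star(\cdot|s)}r(s,a)-\mathbb E_{a\sim\pi(\cdot|s)}r(s,a)\big]$. Rating model: a human rating of $(s,a)$ is $h(r(s,a),\epsilon)$, where $h$ is a deterministic function and $\epsilon\sim\mathcal N(0,\sigma^2)$ is independent of $(s,a)$. Put $\bar h(r)=\mathbb E_\epsilon[h(r,\epsilon)]$. It is assumed that: 1. $\bar h$ maps $[0,R]$ into $[0,R]$, is strictly increasing, and $\bar h(0)=0$. 2. For every $r\in[0,R]$, $h(r,\epsilon)$ is a degree-$q$ polynomial in $\epsilon$, and $-(h(r,\epsilon)-\mathbb E[h(r,\epsilon)])$ has the same distribution as $h(r,\epsilon)-\mathbb E[h(r,\epsilon)]$. 3. There are positive constants $C_{h,1},C_{h,2}$ such that for all $r_1\ge r_2$ in $[0,R]$: $\bar h^{-1}(r_1)-\bar h^{-1}(r_2)\le C_{h,1}\bar h^{-1}(r_1-r_2)$ and $\bar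 h(r_1)-\bar h(r_2)\le C_{h,2}\bar h(r_1-r_2)$. $V_{R,\sigma}^2$ is an upper bound on $\mathrm{Var}_\epsilon(h(r,\epsilon))$ over all $r\in[0,R]$ (it can depend on $R$ and $\sigma$). The learner does not know $h$ but has an estimate $\widetilde V_{R,\sigma}^2=c_VV_{R,\sigma}^2$, where $c_V>0$ is an absolute constant; $c_b$ is an appropriately chosen constant in the penalty. Dataset: $\mathcal D=\{(s_i,a_i,\widetilde r_i)\}_{i=1}^n$ with $(s_i,a_i)$ i.i.d. from $d$ (a distribution on $\mathcal S\times\mathcal A$) and $\widetilde r_i=h(r(s_i,a_i),\epsilon_i)$, with $\epsilon_i$ i.i.d. $\mathcal N(0,\sigma^2)$. LCB algorithm (input $\mathcal D$, $\delta$): for each $(s,a)$ let $n_{(s,a)}$ be the number of $i$ with $(s_i,a_i)=(s,a)$, let $\widetilde r(s,a)=\frac1{n_{(s,a)}}\sum_{i}\widetilde r_i\mathbf 1\{(s_i,a_i)=(s,a)\}$, and $\widehat r(s,a)=\max\{\widetilde r(s,a)-b_{n_{(s,a)}},0\}$ (with $\widehat r(s,a)=0$ if $n_{(s,a)}=0$). Output $\widehat\pi_{\rm LCB}(s)=\arg\max_{a}\widehat r(s,a)$.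
   Formalization: The sampling distribution d with C*=2 is shown to exist for each n (it may depend on n), since for a fixed or arbitrary such d the suboptimality can tend to 0; the constant c may also depend on the rating model h and the variance bound V, which are fixed first; c_0 is universal. *)

theory Defs
  imports "HOL-Probability.Probability" "HOL-Computational_Algebra.Polynomial"
begin

section \<open>Contextual bandits\<close>

text \<open>States are \<open>{1..S}\<close> and actions are \<open>{1..A}\<close>. Reward functions and policies
  are total functions on \<open>nat\<close>, constrained only on these ranges.\<close>

definition contextual_bandit ::
    "nat \<Rightarrow> nat \<Rightarrow> real \<Rightarrow> (nat \<Rightarrow> nat \<Rightarrow> real) \<Rightarrow> nat pmf \<Rightarrow> bool" where
  "contextual_bandit S A R r \<rho> \<longleftrightarrow>
     1 \<le> S \<and> 1 \<le> A \<and>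
     (\<forall>s\<in>{1..S}. \<forall>a\<in>{1..A}. 0 \<le> r s a \<and> r s a \<le> R) \<and>
     set_pmf \<rho> \<subseteq> {1..S}"

definition is_policy :: "nat \<Rightarrow> nat \<Rightarrow> (nat \<Rightarrow> nat pmf) \<Rightarrow> bool" where
  "is_policy S A \<pi> \<longleftrightarrow> (\<forall>s\<in>{1..S}. set_pmf (\<pi> s) \<subseteq> {1..A})"

definition policy_value :: "(nat \<Rightarrow> nat \<Rightarrow> real) \<Rightarrow> (nat \<Rightarrow> nat pmf) \<Rightarrow> nat \<Rightarrow> real" where
  "policy_value r \<pi> s = measure_pmf.expectation (\<pi> s) (r s)"

definition optimal_policy ::
    "nat \<Rightarrow> nat \<Rightarrow> (nat \<Rightarrow> nat \<Rightarrow> real) \<Rightarrow> (nat \<Rightarrow> nat pmf) \<Rightarrow> bool" where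
  "optimal_policy S A r \<pi>s \<longleftrightarrow>
     is_policy S A \<pi>s \<and>
     (\<forall>\<pi>. is_policy S A \<pi> \<longrightarrow> (\<forall>s\<in>{1..S}. policy_value r \<pi> s \<le> policy_value r \<pi>s s))"

definition visitation :: "nat pmf \<Rightarrow> (nat \<Rightarrow> nat pmf) \<Rightarrow> nat \<Rightarrow> nat \<Rightarrow> real" where
  "visitation \<rho> \<pi> s a = pmf \<rho> s * pmf (\<pi> s) a"

definition subopt ::
    "nat pmf \<Rightarrow> (nat \<Rightarrow> nat \<Rightarrow> real) \<Rightarrow> (nat \<Rightarrow> nat pmf) \<Rightarrow> (nat \<Rightarrow> nat pmf) \<Rightarrow> real" where
  "subopt \<rho> r \<pi>s \<pi> =
     measure_pmf.expectation \<rho> (\<lambda>s. policy_value r \<pi>s s - policy_value r \<pi> s)"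

definition partial_coverage ::
    "nat \<Rightarrow> nat \<Rightarrow> nat pmf \<Rightarrow> (nat \<Rightarrow> nat pmf) \<Rightarrow> (nat \<times> nat) pmf \<Rightarrow> bool" where
  "partial_coverage S A \<rho> \<pi>s d \<longleftrightarrow>
     (\<forall>s\<in>{1..S}. \<forall>a\<in>{1..A}. visitation \<rho> \<pi>s s a > 0 \<longrightarrow> pmf d (s, a) > 0)"

definition concentrability ::
    "nat \<Rightarrow> nat \<Rightarrow> nat pmf \<Rightarrow> (nat \<Rightarrow> nat pmf) \<Rightarrow> (nat \<times> nat) pmf \<Rightarrow> real" where
  "concentrability S A \<rho> \<pi>s d =
     Max {visitation \<rho> \<pi>s s a / pmf d (s, a) | s a.
            s \<in> {1..S} \<and> a \<in> {1..A} \<and> pmf d (s, a) > 0}"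

section \<open>Human ratings\<close>

text \<open>\<open>normal_density\<close> takes the standard deviation, so this is the law with variance
  \<open>\<sigma>\<^sup>2\<close>.\<close>

definition noise :: "real \<Rightarrow> real measure" where
  "noise \<sigma> = density lborel (\<lambda>x. ennreal (normal_density 0 \<sigma> x))"

definition mean_rating :: "(real \<Rightarrow> real \<Rightarrow> real) \<Rightarrow> real \<Rightarrow> real \<Rightarrow> real" where
  "mean_rating h \<sigma> r = prob_space.expectation (noise \<sigma>) (h r)"

definition mean_rating_inv :: "(real \<Rightarrow> real \<Rightarrow> real) \<Rightarrow> real \<Rightarrow> real \<Rightarrow> real \<Rightarrow> real" where
  "mean_rating_inv h \<sigma> R = inv_into {0..R} (mean_rating h \<sigma>)"

text \<open>The mean rating maps \<open>{0..R}\<close> into, not necessarily onto, itself. The condition on its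
  inverse is therefore imposed exactly where all three values of the inverse exist.\<close>

definition rating_model :: "(real \<Rightarrow> real \<Rightarrow> real) \<Rightarrow> nat \<Rightarrow> real \<Rightarrow> real \<Rightarrow> bool" where
  "rating_model h q \<sigma> R \<longleftrightarrow>
     mean_rating h \<sigma> ` {0..R} \<subseteq> {0..R} \<and>
     strict_mono_on {0..R} (mean_rating h \<sigma>) \<and>
     mean_rating h \<sigma> 0 = 0 \<and>
     (\<forall>r\<in>{0..R}.
        (\<exists>p :: real poly. degree p = q \<and> (\<forall>e. h r e = poly p e)) \<and>
        distr (noise \<sigma>) borel (\<lambda>e. - (h r e - mean_rating h \<sigma> r)) =
        distr (noise \<sigma>) borel (\<lambda>e. h r e - mean_rating h \<sigma> r)) \<and>
     (\<exists>C1 C2. C1 > 0 \<and> C2 > 0 \<and>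
        (\<forall>r1 r2. r2 \<le> r1 \<and> {r1, r2, r1 - r2} \<subseteq> mean_rating h \<sigma> ` {0..R} \<longrightarrow>
           mean_rating_inv h \<sigma> R r1 - mean_rating_inv h \<sigma> R r2
             \<le> C1 * mean_rating_inv h \<sigma> R (r1 - r2)) \<and>
        (\<forall>r1\<in>{0..R}. \<forall>r2\<in>{0..R}. r2 \<le> r1 \<longrightarrow>
           mean_rating h \<sigma> r1 - mean_rating h \<sigma> r2 \<le> C2 * mean_rating h \<sigma> (r1 - r2)))"

definition rating_variance_bound ::
    "(real \<Rightarrow> real \<Rightarrow> real) \<Rightarrow> real \<Rightarrow> real \<Rightarrow> real \<Rightarrow> bool" where
  "rating_variance_bound h \<sigma> R V2 \<longleftrightarrow>
     (\<forall>r\<in>{0..R}. prob_space.variance (noise \<sigma>) (h r) \<le> V2)"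

section \<open>The data set and the LCB algorithm\<close>

type_synonym dataset = "nat \<Rightarrow> nat \<times> nat \<times> real"

text \<open>The law of one sample. \<open>distr\<close> is a probability measure only if the map is measurable,
  so \<open>h (r s a)\<close> has to be measurable for all \<open>s\<close> and \<open>a\<close>; for a rating model this
  holds if, e.g., \<open>r\<close> is \<open>0\<close> outside the state and action ranges. Otherwise \<open>distr\<close> is the
  zero measure.\<close>

definition rated_sample ::
    "(real \<Rightarrow> real \<Rightarrow> real) \<Rightarrow> real \<Rightarrow> (nat \<Rightarrow> nat \<Rightarrow> real) \<Rightarrow> (nat \<times> nat) pmf \<Rightarrow>
     (nat \<times> nat \<times> real) measure" where
  "rated_sample h \<sigma> r d =
     distr (measure_pmf d \<Otimes>\<^sub>M noise \<sigma>)
       (count_space UNIV \<Otimes>\<^sub>M (count_space UNIV \<Otimes>\<^sub>M borel))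
       (\<lambda>((s, a), e). (s, a, h (r s a) e))"

definition dataset_law ::
    "(real \<Rightarrow> real \<Rightarrow> real) \<Rightarrow> real \<Rightarrow> (nat \<Rightarrow> nat \<Rightarrow> real) \<Rightarrow> (nat \<times> nat) pmf \<Rightarrow> nat \<Rightarrow>
     dataset measure" where
  "dataset_law h \<sigma> r d n = Pi\<^sub>M {1..n} (\<lambda>_. rated_sample h \<sigma> r d)"

definition samples_at :: "nat \<Rightarrow> dataset \<Rightarrow> nat \<Rightarrow> nat \<Rightarrow> nat set" where
  "samples_at n D s a = {i \<in> {1..n}. \<exists>x. D i = (s, a, x)}"

definition empirical_rating :: "nat \<Rightarrow> dataset \<Rightarrow> nat \<Rightarrow> nat \<Rightarrow> real" where
  "empirical_rating n D s a =
     (\<Sum>i\<in>samples_at n D s a. snd (snd (D i))) / real (card (samples_at n D s a))"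

definition penalty :: "real \<Rightarrow> real \<Rightarrow> nat \<Rightarrow> nat \<Rightarrow> real \<Rightarrow> nat \<Rightarrow> real" where
  "penalty cb V2 S A \<delta> m = cb * sqrt (V2 * ln (real (S * A) / \<delta>) / real m)"

definition lcb_reward :: "(nat \<Rightarrow> real) \<Rightarrow> nat \<Rightarrow> dataset \<Rightarrow> nat \<Rightarrow> nat \<Rightarrow> real" where
  "lcb_reward b n D s a =
     (if samples_at n D s a = {} then 0
      else max (empirical_rating n D s a - b (card (samples_at n D s a))) 0)"

text \<open>A possible output of the algorithm, as a map from data sets to deterministic policies.
  Ties in the argmax may be broken in any way, possibly depending on the data, that keeps
  the output a random variable under the law \<open>M\<close> of the data set.\<close>

definition lcb_output ::
    "dataset measure \<Rightarrow> nat \<Rightarrow> nat \<Rightarrow> (nat \<Rightarrow> real) \<Rightarrow> nat \<Rightarrow> (dataset \<Rightarrow> nat \<Rightarrow> nat) \<Rightarrow> bool" where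
  "lcb_output M S A b n act \<longleftrightarrow>
     (\<forall>s\<in>{1..S}.
        (\<lambda>D. act D s) \<in> M \<rightarrow>\<^sub>M count_space UNIV \<and>
        (\<forall>D\<in>space M. is_arg_max (lcb_reward b n D s) (\<lambda>a. a \<in> {1..A}) (act D s)))"

end

theory Submission
  imports Defs "HOL-Real_Asymp.Real_Asymp"
begin

text \<open>There is a single state, action 1 has reward \<open>R\<close> and is sampled with probability
  \<open>1/2\<close>, and all other actions have reward 0. A symmetric polynomial rating of degree at least 2
  exceeds \<open>x\<close> with probability at least \<open>exp (-O(x))\<close>, whereas the penalty after one
  sample is only of order \<open>sqrt (ln A)\<close>. So, with \<open>N\<close> bad actions and \<open>p\<close> the probability that
  a rating of a bad action exceeds the penalty by \<open>R + 1\<close>, \<open>N * p\<close> is large once \<open>N\<close> is.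
  Each bad action is sampled with probability \<open>1 / (N * p * n)\<close>; a dummy action takes the
  remaining mass. The number of samples with such an extreme rating then has mean 1, while
  the probability that one of them belongs to an action that is sampled again is at most
  \<open>1 / (N * p)\<close>. By Chebyshev's inequality the average rating of action 1 is below \<open>R + 1\<close>
  with high probability, so with constant probability LCB prefers a bad action.\<close>

section \<open>Tail bounds for polynomials in Gaussian noise\<close>

lemma prob_space_noise: "\<sigma> > 0 \<Longrightarrow> prob_space (noise \<sigma>)"
  unfolding noise_def by (rule prob_space_normal_density)

lemma space_noise [simp]: "space (noise \<sigma>) = UNIV"
  and sets_noise [simp, measurable_cong]: "sets (noise \<sigma>) = sets borel"
  by (simp_all add: noise_def)

lemma poly_measurable [measurable]: "poly (p :: real poly) \<in> borel_measurable borel"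
  by (intro borel_measurable_continuous_onI continuous_intros)

lemma integrable_noise_poly:
  assumes "\<sigma> > 0"
  shows "integrable (noise \<sigma>) (poly p)"
proof -
  have "integrable (noise \<sigma>) (\<lambda>e. e ^ k)" for k
    using integrable_normal_moment[OF assms, of 0 k]
    unfolding noise_def by (subst integrable_real_density) (auto simp: integrable_real_density)
  then have "integrable (noise \<sigma>) (\<lambda>e. \<Sum>k\<le>degree p. coeff p k * e ^ k)"
    by (intro Bochner_Integration.integrable_sum integrable_mult_right)
  then show ?thesis
    by (simp add: poly_altdef[abs_def])
qed

text \<open>The density decreases on the nonnegative half-line, so already the interval
  \<open>{y<..y+1}\<close> has mass at least the density at its right end.\<close>

lemma noise_tail_ge:
  assumes "\<sigma> > 0" "y \<ge> 0"
  shows "measure (noise \<sigma>) {y<..} \<ge> normal_density 0 \<sigma> (y + 1)"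
proof -
  interpret prob_space "noise \<sigma>" using assms by (intro prob_space_noise)
  have le: "normal_density 0 \<sigma> (y + 1) \<le> normal_density 0 \<sigma> x" if "x \<in> {y<..y+1}" for x
    using that assms unfolding normal_density_def
    by (intro mult_left_mono) (auto simp: divide_right_mono power_mono)
  have "ennreal (normal_density 0 \<sigma> (y + 1)) =
      (\<integral>\<^sup>+x. ennreal (normal_density 0 \<sigma> (y + 1)) * indicator {y<..y+1} x \<partial>lborel)"
    by (simp add: nn_integral_cmult_indicator)
  also have "\<dots> \<le> (\<integral>\<^sup>+x. ennreal (normal_density 0 \<sigma> x) * indicator {y<..} x \<partial>lborel)"
    by (intro nn_integral_mono) (auto simp: indicator_def intro!: ennreal_leI le)
  also have "\<dots> = emeasure (noise \<sigma>) {y<..}"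
    unfolding noise_def by (subst emeasure_density) auto
  finally show ?thesis
    by (simp add: emeasure_eq_measure)
qed

text \<open>The quotient of \<open>poly p x\<close> by \<open>x ^ degree p\<close> tends to a
  nonzero limit, so its absolute value eventually exceeds \<open>l / 2\<close>; beyond 1,
  \<open>x ^ degree p\<close> dominates \<open>x\<^sup>2\<close>. This quadratic growth turns a
  Gaussian tail of the noise into an exponential tail of the rating.\<close>

lemma poly_abs_ge_square:
  fixes p :: "real poly"
  assumes "degree p \<ge> 2"
  obtains c K where "c > 0" "\<And>x. x \<ge> K \<Longrightarrow> \<bar>poly p x\<bar> \<ge> c * x\<^sup>2"
proof -
  define l where "l = \<bar>lead_coeff p\<bar>"
  have "p \<noteq> 0" using assms by auto
  then have l: "l > 0" by (simp add: l_def)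
  have "((\<lambda>x. poly p x / x ^ degree p) \<longlongrightarrow> lead_coeff p) at_top"
    using poly_divide_tendsto_aux at_top_le_at_infinity by (rule tendsto_mono[rotated])
  then have "((\<lambda>x. \<bar>poly p x / x ^ degree p\<bar>) \<longlongrightarrow> l) at_top"
    unfolding l_def by (intro tendsto_rabs)
  then have "eventually (\<lambda>x. \<bar>poly p x / x ^ degree p\<bar> > l / 2) at_top"
    using l by (intro order_tendstoD) auto
  then obtain K where K: "\<And>x. x \<ge> K \<Longrightarrow> \<bar>poly p x / x ^ degree p\<bar> > l / 2"
    by (auto simp: eventually_at_top_linorder)
  have "\<bar>poly p x\<bar> \<ge> l / 2 * x\<^sup>2" if "x \<ge> max K 1" for x
  proof -
    have "l / 2 * x\<^sup>2 \<le> l / 2 * x ^ degree p"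
      using that l assms by (intro mult_left_mono power_increasing) auto
    also have "\<dots> \<le> \<bar>poly p x\<bar>"
      using K[of x] that by (simp add: abs_divide pos_less_divide_eq)
    finally show ?thesis .
  qed
  then show thesis using that[of "l / 2" "max K 1"] l by auto
qed

text \<open>Symmetry makes both tails equal; without it the polynomial could be bounded above.\<close>

lemma symmetric_poly_noise_tail_ge:
  fixes p :: "real poly"
  assumes \<sigma>: "\<sigma> > 0" and deg: "degree p \<ge> 2"
    and sym: "distr (noise \<sigma>) borel (\<lambda>e. - poly p e) = distr (noise \<sigma>) borel (poly p)"
  obtains a b x0 where "a > 0" "b > 0"
    "\<And>x. x \<ge> x0 \<Longrightarrow> measure (noise \<sigma>) {e. poly p e > x} \<ge> a * exp (- b * x)"
proof -
  interpret prob_space "noise \<sigma>" using \<sigma> by (rule prob_space_noise)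
  obtain c K where c: "c > 0" and K: "\<And>x. x \<ge> K \<Longrightarrow> \<bar>poly p x\<bar> \<ge> c * x\<^sup>2"
    using poly_abs_ge_square[OF deg] by blast
  \<comment> \<open>Read off from the Gaussian density at \<open>y + 1\<close>, where
    \<open>c * y\<^sup>2 = x\<close>: by \<open>(y + 1)\<^sup>2 \<le> 2 * y\<^sup>2 + 2\<close> its
    exponent is at least \<open>- b * x - 1 / \<sigma>\<^sup>2\<close>. The last factor 1/2 in
    \<open>a\<close> shares the mass between two equal tails.\<close>
  define a where "a = exp (- (1 / \<sigma>\<^sup>2)) / sqrt (2 * pi * \<sigma>\<^sup>2) / 2"
  define b where "b = 1 / (c * \<sigma>\<^sup>2)"
  have "measure (noise \<sigma>) {e. poly p e > x} \<ge> a * exp (- b * x)" if x: "x \<ge> c * (max K 0)\<^sup>2" for x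
  proof -
    \<comment> \<open>Noise beyond this \<open>y\<close> forces
      \<open>\<bar>poly p e\<bar> > x\<close>, and the lower bound on \<open>x\<close> ensures
      \<open>y \<ge> K\<close>.\<close>
    define y where "y = sqrt (x / c)"
    have "0 \<le> c * (max K 0)\<^sup>2" using c by simp
    with x have x0: "x \<ge> 0" by linarith
    have y0: "y \<ge> 0" using x0 c by (simp add: y_def)
    have yK: "y \<ge> max K 0"
      unfolding y_def using x c by (intro real_le_rsqrt) (simp add: field_simps)
    have y2: "c * y\<^sup>2 = x" using x0 c by (simp add: y_def)
    have "measure (noise \<sigma>) {e. poly p e < - x} =
        measure (distr (noise \<sigma>) borel (\<lambda>e. - poly p e)) {x<..}"
      by (subst measure_distr) (auto intro!: arg_cong[where f = "measure _"])
    also have "\<dots> = measure (noise \<sigma>) {e. poly p e > x}"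
      unfolding sym by (subst measure_distr) (auto intro!: arg_cong[where f = "measure _"])
    finally have lower: "measure (noise \<sigma>) {e. poly p e < - x} = measure (noise \<sigma>) {e. poly p e > x}" .
    have sub: "{y<..} \<subseteq> {e. poly p e < - x} \<union> {e. poly p e > x}"
    proof
      fix e assume "e \<in> {y<..}"
      then have e: "e > y" by simp
      then have "y\<^sup>2 < e\<^sup>2" using y0 by (intro power_strict_mono) auto
      then have "x < c * e\<^sup>2" using c y2 by auto
      also have "\<dots> \<le> \<bar>poly p e\<bar>" using e yK by (intro K) auto
      finally show "e \<in> {e. poly p e < - x} \<union> {e. poly p e > x}" by auto
    qed
    have "normal_density 0 \<sigma> (y + 1) \<le> measure (noise \<sigma>) {y<..}"
      using \<sigma> y0 by (rule noise_tail_ge)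
    also have "\<dots> \<le> measure (noise \<sigma>) ({e. poly p e < - x} \<union> {e. poly p e > x})"
      using sub by (intro finite_measure_mono) auto
    also have "\<dots> \<le> measure (noise \<sigma>) {e. poly p e < - x} + measure (noise \<sigma>) {e. poly p e > x}"
      by (intro measure_Un_le) auto
    finally have 1: "normal_density 0 \<sigma> (y + 1) \<le> 2 * measure (noise \<sigma>) {e. poly p e > x}"
      using lower by simp
    have "(y + 1)\<^sup>2 \<le> 2 * y\<^sup>2 + 2"
      using sum_squares_bound[of y 1] by (simp add: power2_sum)
    then have "(y + 1)\<^sup>2 / (2 * \<sigma>\<^sup>2) \<le> (2 * y\<^sup>2 + 2) / (2 * \<sigma>\<^sup>2)"
      by (intro divide_right_mono) auto
    also have "\<dots> = b * x + 1 / \<sigma>\<^sup>2"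
      unfolding b_def y2[symmetric] using c \<sigma> by (simp add: field_simps)
    finally have "exp (- (1 / \<sigma>\<^sup>2)) * exp (- b * x) \<le> exp (- ((y + 1)\<^sup>2 / (2 * \<sigma>\<^sup>2)))"
      by (simp flip: exp_add)
    then have "2 * (a * exp (- b * x)) \<le> normal_density 0 \<sigma> (y + 1)"
      unfolding a_def normal_density_def by (simp add: divide_right_mono)
    with 1 show ?thesis by linarith
  qed
  moreover have "a > 0" "b > 0" using c \<sigma> by (auto simp: a_def b_def)
  ultimately show thesis using that by blast
qed

text \<open>The threshold grows only like the square root of \<open>ln N\<close>, so the exponential
  tail bound decays more slowly than any negative power of \<open>N\<close>, and its product with
  \<open>N\<close> is unbounded. In the hard instance \<open>N\<close> counts the bad actions and
  \<open>N + 2\<close> all actions.\<close>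

lemma symmetric_poly_noise_tail_many:
  fixes p :: "real poly" and T C B :: real
  assumes "\<sigma> > 0" "degree p \<ge> 2"
    and "distr (noise \<sigma>) borel (\<lambda>e. - poly p e) = distr (noise \<sigma>) borel (poly p)"
    and \<delta>: "\<delta> > 0" and C: "C \<ge> 0"
  obtains N :: nat where "N \<ge> 1"
    "real N * measure (noise \<sigma>) {e. poly p e > T + C * sqrt (ln (real (N + 2) / \<delta>))} \<ge> B"
proof -
  obtain a b x0 where ab: "a > 0" "b > 0"
    and tail: "\<And>x. x \<ge> x0 \<Longrightarrow> measure (noise \<sigma>) {e. poly p e > x} \<ge> a * exp (- b * x)"
    using symmetric_poly_noise_tail_ge[OF assms(1-3)] by blast
  \<comment> \<open>With \<open>C + 1\<close> in place of \<open>C\<close>, \<open>x N\<close> tends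
    to infinity even for \<open>C = 0\<close>, as the tail bound requires; raising a threshold only
    shrinks the tail.\<close>
  define x where "x N = T + (C + 1) * sqrt (ln (real (N + 2) / \<delta>))" for N :: nat
  have "filterlim x at_top at_top"
    using C \<delta> unfolding x_def by real_asymp
  then have "eventually (\<lambda>N. x N \<ge> x0) at_top"
    by (simp add: filterlim_at_top)
  moreover have "filterlim (\<lambda>N. real N * (a * exp (- b * x N))) at_top at_top"
    using C ab \<delta> unfolding x_def by real_asymp
  then have "eventually (\<lambda>N. real N * (a * exp (- b * x N)) \<ge> B) at_top"
    by (simp add: filterlim_at_top)
  \<comment> \<open>This keeps the logarithm and its root nonnegative, so that going back from
    \<open>C + 1\<close> to \<open>C\<close> lowers the threshold.\<close>
  moreover have "eventually (\<lambda>N. real (N + 2) / \<delta> \<ge> 1) at_top"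
    using \<delta> by real_asymp
  ultimately have "eventually (\<lambda>N. x N \<ge> x0 \<and> real N * (a * exp (- b * x N)) \<ge> B \<and>
      real (N + 2) / \<delta> \<ge> 1 \<and> N \<ge> 1) at_top"
    using eventually_ge_at_top[of 1] by eventually_elim auto
  then obtain N where N: "x N \<ge> x0" "real N * (a * exp (- b * x N)) \<ge> B"
      "real (N + 2) / \<delta> \<ge> 1" "N \<ge> 1"
    by (auto simp: eventually_at_top_linorder)
  interpret prob_space "noise \<sigma>" using assms(1) by (rule prob_space_noise)
  have "T + C * sqrt (ln (real (N + 2) / \<delta>)) \<le> x N"
    unfolding x_def using N(3) by (intro add_left_mono mult_right_mono) auto
  then have "measure (noise \<sigma>) {e. poly p e > x N} \<le>
      measure (noise \<sigma>) {e. poly p e > T + C * sqrt (ln (real (N + 2) / \<delta>))}"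
    by (intro finite_measure_mono) auto
  with tail[OF N(1)] have "a * exp (- b * x N) \<le>
      measure (noise \<sigma>) {e. poly p e > T + C * sqrt (ln (real (N + 2) / \<delta>))}"
    by linarith
  then have "real N * (a * exp (- b * x N)) \<le>
      real N * measure (noise \<sigma>) {e. poly p e > T + C * sqrt (ln (real (N + 2) / \<delta>))}"
    by (intro mult_left_mono) auto
  with N that show thesis by (meson order_trans)
qed

section \<open>Independent samples\<close>

text \<open>The integrand is a product over all coordinates with factor 1 away from
  \<open>i\<close>, so the product formula for integrals applies.\<close>

lemma (in prob_space) integral_PiM_coordinate:
  fixes f :: "'a \<Rightarrow> real"
  assumes I: "finite I" "i \<in> I" and f: "integrable M f"
  shows "integrable (Pi\<^sub>M I (\<lambda>_. M)) (\<lambda>x. f (x i))"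
    and "(\<integral>x. f (x i) \<partial>Pi\<^sub>M I (\<lambda>_. M)) = expectation f"
proof -
  interpret P: product_sigma_finite "\<lambda>_::'b. M" ..
  define F where "F k = (if k = i then f else (\<lambda>_. 1))" for k
  have F: "integrable M (F k)" for k using f by (auto simp: F_def)
  have eq: "(\<Prod>k\<in>I. F k (x k)) = f (x i)" for x
  proof -
    have "(\<Prod>k\<in>I. F k (x k)) = (\<Prod>k\<in>I. if k = i then f (x k) else 1)"
      by (intro prod.cong) (auto simp: F_def)
    then show ?thesis using I by (simp add: prod.delta)
  qed
  have "(\<Prod>k\<in>I. expectation (F k)) = (\<Prod>k\<in>I. if k = i then expectation f else 1)"
    by (intro prod.cong) (auto simp: F_def prob_space)
  then have eq': "(\<Prod>k\<in>I. expectation (F k)) = expectation f" using I by (simp add: prod.delta)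
  show "integrable (Pi\<^sub>M I (\<lambda>_. M)) (\<lambda>x. f (x i))"
    using P.product_integrable_prod[of I F] I F by (simp add: eq)
  show "(\<integral>x. f (x i) \<partial>Pi\<^sub>M I (\<lambda>_. M)) = expectation f"
    using P.product_integral_prod[of I F] I F by (simp add: eq eq')
qed

text \<open>The same device with two nontrivial factors: distinct coordinates are independent. It
  serves both the variance of an i.i.d. sum and the collision bound.\<close>

lemma (in prob_space) integral_PiM_two_coordinates:
  fixes f g :: "'a \<Rightarrow> real"
  assumes I: "finite I" "i \<in> I" "j \<in> I" "i \<noteq> j" and f: "integrable M f" and g: "integrable M g"
  shows "integrable (Pi\<^sub>M I (\<lambda>_. M)) (\<lambda>x. f (x i) * g (x j))"
    and "(\<integral>x. f (x i) * g (x j) \<partial>Pi\<^sub>M I (\<lambda>_. M)) = expectation f * expectation g"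
proof -
  interpret P: product_sigma_finite "\<lambda>_::'b. M" ..
  define F where "F k = (if k = i then f else if k = j then g else (\<lambda>_. 1))" for k
  have F: "integrable M (F k)" for k using f g by (auto simp: F_def)
  have prod2: "(\<Prod>k\<in>I. if k = i then u k else if k = j then v k else 1) = u i * v j"
    for u v :: "'b \<Rightarrow> real"
  proof -
    have "(\<Prod>k\<in>I. if k = i then u k else if k = j then v k else 1) =
        (\<Prod>k\<in>{i, j}. if k = i then u k else if k = j then v k else 1)"
      using I by (intro prod.mono_neutral_right) auto
    then show ?thesis using I by simp
  qed
  have eq: "(\<Prod>k\<in>I. F k (x k)) = f (x i) * g (x j)" for x
  proof -
    have "(\<Prod>k\<in>I. F k (x k)) = (\<Prod>k\<in>I. if k = i then f (x k) else if k = j then g (x k) else 1)"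
      by (intro prod.cong) (auto simp: F_def)
    then show ?thesis using prod2[of "\<lambda>k. f (x k)" "\<lambda>k. g (x k)"] by simp
  qed
  have "(\<Prod>k\<in>I. expectation (F k)) =
      (\<Prod>k\<in>I. if k = i then expectation f else if k = j then expectation g else 1)"
    by (intro prod.cong) (auto simp: F_def prob_space)
  then have eq': "(\<Prod>k\<in>I. expectation (F k)) = expectation f * expectation g"
    using prod2[of "\<lambda>_. expectation f" "\<lambda>_. expectation g"] by simp
  show "integrable (Pi\<^sub>M I (\<lambda>_. M)) (\<lambda>x. f (x i) * g (x j))"
    using P.product_integrable_prod[of I F] I F by (simp add: eq)
  show "(\<integral>x. f (x i) * g (x j) \<partial>Pi\<^sub>M I (\<lambda>_. M)) = expectation f * expectation g"
    using P.product_integral_prod[of I F] I F by (simp add: eq eq')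
qed

text \<open>Chebyshev's inequality: with \<open>n = card I\<close>, the sum has mean at most
  \<open>- n * \<mu>\<close>, so a nonnegative value deviates from the mean by at least
  \<open>n * \<mu>\<close>. Cross terms of the centred summands vanish, and the variance is at most
  the second moment.\<close>

lemma (in prob_space) iid_sum_nonneg_prob_le:
  fixes Y :: "'a \<Rightarrow> real"
  assumes I: "finite I" "I \<noteq> {}" and Y: "integrable M Y" "integrable M (\<lambda>x. (Y x)\<^sup>2)"
    and \<mu>: "\<mu> > 0" "expectation Y \<le> - \<mu>"
  shows "measure (Pi\<^sub>M I (\<lambda>_. M)) {D \<in> space (Pi\<^sub>M I (\<lambda>_. M)). 0 \<le> (\<Sum>i\<in>I. Y (D i))}
    \<le> expectation (\<lambda>x. (Y x)\<^sup>2) / (real (card I) * \<mu>\<^sup>2)"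
proof -
  define P where "P = Pi\<^sub>M I (\<lambda>_. M)"
  interpret P: prob_space P unfolding P_def by (intro prob_space_PiM) unfold_locales
  define Z where "Z x = Y x - expectation Y" for x
  define n where "n = real (card I)"
  have n: "n > 0" using I by (simp add: n_def card_gt_0_iff)
  have [measurable]: "Y \<in> borel_measurable M" using Y by auto
  have [measurable]: "Z \<in> borel_measurable M" unfolding Z_def[abs_def] by simp
  have Z: "integrable M Z" unfolding Z_def[abs_def] using Y by simp
  have Z2: "integrable M (\<lambda>x. Z x * Z x)"
    unfolding Z_def using Y by (simp add: algebra_simps power2_eq_square)
  have EZ: "expectation Z = 0" unfolding Z_def using Y by (simp add: prob_space)
  have "expectation (\<lambda>x. Z x * Z x) = expectation (\<lambda>x. (Y x)\<^sup>2) - (expectation Y)\<^sup>2"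
    using variance_eq[OF Y] unfolding Z_def by (simp add: power2_eq_square)
  then have VZ: "expectation (\<lambda>x. Z x * Z x) \<le> expectation (\<lambda>x. (Y x)\<^sup>2)" by simp
  have prods: "integrable P (\<lambda>D. Z (D i) * Z (D j))"
      "P.expectation (\<lambda>D. Z (D i) * Z (D j)) = (if i = j then expectation (\<lambda>x. Z x * Z x) else 0)"
    if "i \<in> I" "j \<in> I" for i j
    using integral_PiM_coordinate[OF I(1) that(1) Z2] integral_PiM_two_coordinates[OF I(1) that _ Z Z]
    by (auto simp: P_def EZ)
  have sq: "(\<Sum>i\<in>I. Z (D i))\<^sup>2 = (\<Sum>i\<in>I. \<Sum>j\<in>I. Z (D i) * Z (D j))" for D
    by (simp add: power2_eq_square sum_product)
  have int: "integrable P (\<lambda>D. (\<Sum>i\<in>I. Z (D i))\<^sup>2)"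
    unfolding sq by (intro Bochner_Integration.integrable_sum prods)
  have "P.expectation (\<lambda>D. (\<Sum>i\<in>I. Z (D i))\<^sup>2) =
      (\<Sum>i\<in>I. \<Sum>j\<in>I. P.expectation (\<lambda>D. Z (D i) * Z (D j)))"
    unfolding sq using prods(1) by simp
  also have "\<dots> = (\<Sum>i\<in>I. \<Sum>j\<in>I. if i = j then expectation (\<lambda>x. Z x * Z x) else 0)"
    by (intro sum.cong refl prods)
  also have "\<dots> = n * expectation (\<lambda>x. Z x * Z x)"
    using I by (simp add: n_def)
  also have "\<dots> \<le> n * expectation (\<lambda>x. (Y x)\<^sup>2)"
    using VZ n by (intro mult_left_mono) auto
  finally have E: "P.expectation (\<lambda>D. (\<Sum>i\<in>I. Z (D i))\<^sup>2) \<le> n * expectation (\<lambda>x. (Y x)\<^sup>2)" .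
  have "P.prob {D \<in> space P. 0 \<le> (\<Sum>i\<in>I. Y (D i))} \<le>
      P.prob {D \<in> space P. (n * \<mu>)\<^sup>2 \<le> (\<Sum>i\<in>I. Z (D i))\<^sup>2}"
  proof (intro P.finite_measure_mono subsetI)
    fix D assume "D \<in> {D \<in> space P. 0 \<le> (\<Sum>i\<in>I. Y (D i))}"
    then have D: "D \<in> space P" "0 \<le> (\<Sum>i\<in>I. Y (D i))" by auto
    have "(\<Sum>i\<in>I. Z (D i)) = (\<Sum>i\<in>I. Y (D i)) - n * expectation Y"
      by (simp add: Z_def sum_subtractf n_def)
    moreover have "n * \<mu> \<le> n * (- expectation Y)" using n \<mu> by (intro mult_left_mono) auto
    ultimately have "n * \<mu> \<le> (\<Sum>i\<in>I. Z (D i))" using D by simp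
    then show "D \<in> {D \<in> space P. (n * \<mu>)\<^sup>2 \<le> (\<Sum>i\<in>I. Z (D i))\<^sup>2}"
      using D n \<mu> by (auto intro!: power_mono)
  next
    show "{D \<in> space P. (n * \<mu>)\<^sup>2 \<le> (\<Sum>i\<in>I. Z (D i))\<^sup>2} \<in> sets P"
      unfolding P_def by measurable
  qed
  also have "\<dots> \<le> P.expectation (\<lambda>D. (\<Sum>i\<in>I. Z (D i))\<^sup>2) / (n * \<mu>)\<^sup>2"
    using n \<mu> by (intro integral_Markov_inequality_measure[OF int, of "{}"]) auto
  also have "\<dots> \<le> n * expectation (\<lambda>x. (Y x)\<^sup>2) / (n * \<mu>)\<^sup>2"
    using E by (intro divide_right_mono) auto
  also have "\<dots> = expectation (\<lambda>x. (Y x)\<^sup>2) / (n * \<mu>\<^sup>2)"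
    using n by (simp add: power2_eq_square)
  finally show ?thesis unfolding P_def n_def .
qed

text \<open>Avoiding \<open>B\<close> in every coordinate is a product set.\<close>

lemma (in prob_space) iid_avoid_prob:
  assumes I: "finite I" and B: "B \<in> events"
  shows "measure (Pi\<^sub>M I (\<lambda>_. M)) {D \<in> space (Pi\<^sub>M I (\<lambda>_. M)). \<forall>i\<in>I. D i \<notin> B} =
    (1 - prob B) ^ card I"
proof -
  interpret P: finite_product_prob_space "\<lambda>_. M" I
    using I by unfold_locales
  have "{D \<in> space (Pi\<^sub>M I (\<lambda>_. M)). \<forall>i\<in>I. D i \<notin> B} = (\<Pi>\<^sub>E i\<in>I. space M - B)"
    by (auto simp: space_PiM PiE_iff extensional_def)
  then show ?thesis
    using P.prob_times[of "\<lambda>_. space M - B"] B by (simp add: prob_compl)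
qed

text \<open>Union bound over ordered pairs of distinct indices and over \<open>F\<close>; by
  independence each single event has probability \<open>u * w\<close>. Counting the diagonal pairs
  too gives the square of \<open>card I\<close>.\<close>

lemma (in prob_space) iid_collision_prob_le:
  assumes I: "finite I" and F: "finite F"
    and U: "\<And>a. a \<in> F \<Longrightarrow> U a \<in> events" "\<And>a. a \<in> F \<Longrightarrow> prob (U a) = u"
    and W: "\<And>a. a \<in> F \<Longrightarrow> W a \<in> events" "\<And>a. a \<in> F \<Longrightarrow> prob (W a) = w"
  defines "S \<equiv> {D \<in> space (Pi\<^sub>M I (\<lambda>_. M)).
    \<exists>i\<in>I. \<exists>j\<in>I. i \<noteq> j \<and> (\<exists>a\<in>F. D i \<in> U a \<and> D j \<in> W a)}"
  shows "S \<in> sets (Pi\<^sub>M I (\<lambda>_. M))"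
    and "measure (Pi\<^sub>M I (\<lambda>_. M)) S \<le> (real (card I))\<^sup>2 * (real (card F) * (u * w))"
proof -
  define P where "P = Pi\<^sub>M I (\<lambda>_. M)"
  interpret P: prob_space P unfolding P_def by (intro prob_space_PiM) unfold_locales
  define X where "X = {(i, j, a). i \<in> I \<and> j \<in> I \<and> i \<noteq> j \<and> a \<in> F}"
  define E where "E = (\<lambda>(i, j, a). {D \<in> space P. D i \<in> U a \<and> D j \<in> W a})"
  have X: "X \<subseteq> I \<times> I \<times> F" by (auto simp: X_def)
  then have finX: "finite X" using I F by (meson finite_SigmaI finite_subset)
  have S: "S = (\<Union>x\<in>X. E x)" by (auto simp: S_def X_def E_def P_def)
  have E: "E x \<in> sets P" "P.prob (E x) = u * w" if x: "x \<in> X" for x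
  proof -
    obtain i j a where x_eq: "x = (i, j, a)" and ij: "i \<in> I" "j \<in> I" "i \<noteq> j" and a: "a \<in> F"
      using x by (auto simp: X_def)
    have [measurable]: "U a \<in> events" "W a \<in> events" using U W a by auto
    note ij(1,2)[measurable]
    show meas: "E x \<in> sets P" unfolding x_eq E_def P_def prod.case by measurable
    have "P.prob (E x) = P.expectation (indicator (E x))" using meas by simp
    also have "\<dots> = P.expectation (\<lambda>D. indicator (U a) (D i) * indicator (W a) (D j))"
      by (intro Bochner_Integration.integral_cong) (auto simp: x_eq E_def indicator_def)
    also have "\<dots> = expectation (indicator (U a)) * expectation (indicator (W a))"
      unfolding P_def using I ij
      by (intro integral_PiM_two_coordinates integrable_real_indicator) (auto simp: emeasure_eq_measure)
    also have "\<dots> = u * w" using U W a by simp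
    finally show "P.prob (E x) = u * w" .
  qed
  show "S \<in> sets (Pi\<^sub>M I (\<lambda>_. M))"
    using E(1) finX unfolding S P_def by auto
  show "measure (Pi\<^sub>M I (\<lambda>_. M)) S \<le> (real (card I))\<^sup>2 * (real (card F) * (u * w))"
  \<comment> \<open>The signs of \<open>u\<close> and \<open>w\<close> are known only if
    \<open>F\<close> has an element, since they are then probabilities.\<close>
  proof (cases "F = {}")
    case False
    then have "u \<ge> 0" "w \<ge> 0" using U(2) W(2) by (metis equals0I measure_nonneg)+
    have "P.prob (\<Union>x\<in>X. E x) \<le> (\<Sum>x\<in>X. P.prob (E x))"
      using E(1) finX by (intro measure_UNION_le) auto
    also have "\<dots> = real (card X) * (u * w)" using E(2) by simp
    also have "\<dots> \<le> real (card (I \<times> I \<times> F)) * (u * w)"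
      using X I F \<open>u \<ge> 0\<close> \<open>w \<ge> 0\<close> by (intro mult_right_mono of_nat_mono card_mono) auto
    finally show ?thesis
      unfolding S P_def by (simp add: card_cartesian_product power2_eq_square mult_ac)
  qed (simp add: S_def)
qed

text \<open>From \<open>1 + x \<le> exp x\<close>, used at \<open>- 1 / n\<close> and at 1.\<close>

lemma one_minus_inverse_power_le_half:
  assumes "n \<ge> 1"
  shows "(1 - 1 / real n) ^ n \<le> 1 / 2"
proof -
  have "(1 - 1 / real n) ^ n \<le> exp (- 1 / real n) ^ n"
    using assms exp_ge_add_one_self[of "- 1 / real n"] by (intro power_mono) auto
  also have "\<dots> = exp (- 1)" using assms by (simp flip: exp_of_nat_mult)
  also have "\<dots> \<le> 1 / 2" using exp_ge_add_one_self[of 1] by (simp add: exp_minus field_simps)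
  finally show ?thesis .
qed

section \<open>Rated samples and the LCB rule\<close>

text \<open>The state-action pair ranges over a countable discrete space, so measurability in the
  noise for each fixed pair suffices.\<close>

lemma rating_measurable:
  fixes h :: "real \<Rightarrow> real \<Rightarrow> real" and r :: "nat \<Rightarrow> nat \<Rightarrow> real"
  assumes "\<And>s a. h (r s a) \<in> borel_measurable borel"
  shows "(\<lambda>((s, a), e). (s, a, h (r s a) e)) \<in>
    measure_pmf d \<Otimes>\<^sub>M noise \<sigma> \<rightarrow>\<^sub>M
    count_space UNIV \<Otimes>\<^sub>M (count_space UNIV \<Otimes>\<^sub>M (borel :: real measure))"
proof -
  have *: "(\<lambda>e. (s, a, h (r s a) e)) \<in> noise \<sigma> \<rightarrow>\<^sub>M
      count_space UNIV \<Otimes>\<^sub>M (count_space UNIV \<Otimes>\<^sub>M (borel :: real measure))"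
    for s a using assms by measurable
  have "(\<lambda>(k, e). (\<lambda>(s, a) e. (s, a, h (r s a) e)) k e) \<in> count_space UNIV \<Otimes>\<^sub>M noise \<sigma> \<rightarrow>\<^sub>M
      count_space UNIV \<Otimes>\<^sub>M (count_space UNIV \<Otimes>\<^sub>M (borel :: real measure))"
    by (intro measurable_pair_measure_countable1) (auto simp: * split: prod.splits)
  also have "?this \<longleftrightarrow> ?thesis"
    by (intro measurable_cong_sets arg_cong2[where f="(\<in>)"])
      (auto simp: fun_eq_iff intro!: sets_pair_measure_cong)
  finally show ?thesis .
qed

lemma prob_space_rated_sample:
  assumes "\<And>s a. h (r s a) \<in> borel_measurable borel" "\<sigma> > 0"
  shows "prob_space (rated_sample h \<sigma> r d)"
proof -
  interpret N: prob_space "noise \<sigma>" using assms by (intro prob_space_noise)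
  interpret pair_prob_space "measure_pmf d" "noise \<sigma>" ..
  show ?thesis
    unfolding rated_sample_def by (intro prob_space_distr rating_measurable assms)
qed

text \<open>Pulled back to the product of \<open>d\<close> and the noise, the integrand is the
  indicator of \<open>(s, a)\<close> times a function of the noise alone, and Fubini separates the
  two. Indicators \<open>f\<close> yield probabilities, polynomials \<open>f\<close> yield moments
  of ratings.\<close>

lemma rated_sample_integral_at:
  fixes f :: "real \<Rightarrow> real"
  assumes h: "\<And>s a. h (r s a) \<in> borel_measurable borel" and \<sigma>: "\<sigma> > 0"
    and f [measurable]: "f \<in> borel_measurable borel"
    and int: "integrable (noise \<sigma>) (\<lambda>e. f (h (r s a) e))"
  shows "integrable (rated_sample h \<sigma> r d) (\<lambda>(s', a', x). if s' = s \<and> a' = a then f x else 0)" (is ?int)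
    and "(\<integral>(s', a', x). (if s' = s \<and> a' = a then f x else 0) \<partial>rated_sample h \<sigma> r d) =
      pmf d (s, a) * (\<integral>e. f (h (r s a) e) \<partial>noise \<sigma>)" (is ?eq)
proof -
  interpret N: prob_space "noise \<sigma>" using assms by (intro prob_space_noise)
  interpret pair_prob_space "measure_pmf d" "noise \<sigma>" ..
  have ind: "(\<lambda>z. indicat_real {(s, a)} (fst z)) \<in> borel_measurable (measure_pmf d \<Otimes>\<^sub>M noise \<sigma>)"
    by (rule measurable_compose[OF measurable_fst]) simp
  have fh: "(\<lambda>z. f (h (r s a) (snd z))) \<in> borel_measurable (measure_pmf d \<Otimes>\<^sub>M noise \<sigma>)"
    using measurable_compose[OF measurable_snd borel_measurable_integrable[OF int]] .
  let ?g = "\<lambda>(k, e). indicat_real {(s, a)} k * f (h (r s a) e)"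
  have eq: "(\<lambda>(s', a', x). if s' = s \<and> a' = a then f x else 0)
      ((\<lambda>((s, a), e). (s, a, h (r s a) e)) z) = ?g z" for z
    by (auto split: prod.splits simp: indicator_def)
  have meas: "(\<lambda>(s', a', x). if s' = s \<and> a' = a then f x else 0) \<in> borel_measurable
      (count_space UNIV \<Otimes>\<^sub>M (count_space UNIV \<Otimes>\<^sub>M (borel :: real measure)))"
    by measurable
  have int_ind: "integrable (measure_pmf d) (indicat_real {(s, a)})"
    by (intro integrable_real_indicator) (auto simp: measure_pmf.emeasure_eq_measure)
  have g: "integrable (measure_pmf d \<Otimes>\<^sub>M noise \<sigma>) ?g"
  proof (rule Fubini_integrable)
    show "?g \<in> borel_measurable (measure_pmf d \<Otimes>\<^sub>M noise \<sigma>)"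
      unfolding split_beta' by (rule borel_measurable_times[OF ind fh])
  qed (use int int_ind in \<open>auto simp: abs_mult\<close>)
  show ?int
    unfolding rated_sample_def
    using integrable_distr_eq[OF rating_measurable[where h = h and r = r, OF h] meas] g by (simp only: eq)
  have "(\<integral>(s', a', x). (if s' = s \<and> a' = a then f x else 0) \<partial>rated_sample h \<sigma> r d) =
      (\<integral>z. ?g z \<partial>(measure_pmf d \<Otimes>\<^sub>M noise \<sigma>))"
    unfolding rated_sample_def
    using integral_distr[OF rating_measurable[where h = h and r = r, OF h] meas] by (simp only: eq)
  also have "\<dots> = (\<integral>k. (\<integral>e. indicator {(s, a)} k * f (h (r s a) e) \<partial>noise \<sigma>) \<partial>measure_pmf d)"
    using integral_fst'[OF g] by simp
  also have "\<dots> = pmf d (s, a) * (\<integral>e. f (h (r s a) e) \<partial>noise \<sigma>)"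
    by (simp add: measure_pmf_single)
  finally show ?eq .
qed

text \<open>Mass 1/2 at action 1 is what makes the concentrability 2. Action \<open>N + 2\<close> is
  the dummy that absorbs the remainder \<open>1/2 - real N * w\<close>.\<close>

lemma exists_sampling_pmf:
  assumes "w \<ge> 0" "real N * w \<le> 1/2"
  obtains d :: "(nat \<times> nat) pmf"
  where "set_pmf d \<subseteq> {1} \<times> {1..N+2}" "pmf d (1, 1) = 1/2" "\<And>a. a \<in> {2..N+1} \<Longrightarrow> pmf d (1, a) = w"
proof -
  define g where "g a = (if a = 1 then 1/2 else if a \<in> {2..N+1} then w
      else if a = N + 2 then 1/2 - real N * w else 0)" for a
  have g0: "g a \<ge> 0" for a using assms by (auto simp: g_def)
  have "{1..N+2} = insert 1 (insert (N+2) {2..N+1})" by auto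
  then have "sum g {1..N+2} = 1/2 + (1/2 - real N * w) + sum g {2..N+1}"
    by (simp add: g_def)
  also have "sum g {2..N+1} = (\<Sum>a\<in>{2..N+1}. w)"
    by (intro sum.cong) (auto simp: g_def)
  finally have sum: "sum g {1..N+2} = 1" by simp
  have "(\<integral>\<^sup>+a. ennreal (g a) \<partial>count_space UNIV) = (\<Sum>a\<in>{1..N+2}. ennreal (g a))"
    by (intro nn_integral_count_space') (auto simp: g_def)
  also have "\<dots> = 1" using g0 sum by (subst sum_ennreal) (auto simp del: sum.cl_ivl_Suc)
  finally have nn: "(\<integral>\<^sup>+a. ennreal (g a) \<partial>count_space UNIV) = 1" .
  define d where "d = map_pmf (Pair (1::nat)) (embed_pmf g)"
  have pmf_d: "pmf d (1, a) = g a" for a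
    unfolding d_def by (subst pmf_map_inj') (auto simp: pmf_embed_pmf[OF g0 nn] inj_on_def)
  have "set_pmf d \<subseteq> {1} \<times> {1..N+2}"
    by (auto simp: d_def set_embed_pmf[OF g0 nn] g_def split: if_splits)
  then show thesis using that[of d] pmf_d by (auto simp: g_def)
qed

text \<open>The deterministic core: a single rating above \<open>T + b 1\<close> leaves action
  \<open>a\<close> with a lower confidence bound above \<open>T\<close>. The sum condition keeps the
  average of \<open>a'\<close> at most \<open>T\<close>, the penalty only lowers it, and without
  samples its value is \<open>0 \<le> T\<close>. The inequality is strict, so any tie-breaking is
  covered.\<close>

lemma lcb_argmax_overestimated:
  assumes n: "i \<in> {1..n}" and Di: "D i = (s, a, x)" and a: "a \<in> B"
    and unique: "\<And>j y. j \<in> {1..n} \<Longrightarrow> D j = (s, a, y) \<Longrightarrow> j = i"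
    and x: "x > T + b 1" and T: "T \<ge> 0" and b: "\<And>m. b m \<ge> 0"
    and sum: "(\<Sum>j\<in>{1..n}. case D j of (s', k, y) \<Rightarrow> if s' = s \<and> k = a' then y - T else 0) \<le> 0"
    and am: "is_arg_max (lcb_reward b n D s) (\<lambda>a. a \<in> B) c"
  shows "c \<noteq> a'"
proof -
  have S: "samples_at n D s a = {i}"
  proof
    show "samples_at n D s a \<subseteq> {i}" unfolding samples_at_def using unique by blast
    show "{i} \<subseteq> samples_at n D s a" unfolding samples_at_def using n Di by simp
  qed
  then have ra: "lcb_reward b n D s a > T"
    using x Di T by (simp add: lcb_reward_def empirical_rating_def)
  have r0: "lcb_reward b n D s a' \<le> T"
  proof (cases "samples_at n D s a' = {}")
    case False
    let ?S = "samples_at n D s a'"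
    have fin: "finite ?S" by (auto simp: samples_at_def)
    have "(\<Sum>j\<in>?S. snd (snd (D j)) - T) =
        (\<Sum>j\<in>?S. case D j of (s', k, y) \<Rightarrow> if s' = s \<and> k = a' then y - T else 0)"
      by (intro sum.cong) (auto simp: samples_at_def)
    also have "\<dots> = (\<Sum>j\<in>{1..n}. case D j of (s', k, y) \<Rightarrow> if s' = s \<and> k = a' then y - T else 0)"
      by (intro sum.mono_neutral_left) (auto simp: samples_at_def split: prod.splits if_splits)
    finally have "(\<Sum>j\<in>?S. snd (snd (D j))) \<le> T * card ?S"
      using sum by (simp add: sum_subtractf mult_ac)
    then have "empirical_rating n D s a' \<le> T"
      using False fin by (simp add: empirical_rating_def divide_le_eq card_gt_0_iff)
    then show ?thesis using False T b[of "card ?S"] by (simp add: lcb_reward_def)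
  qed (use T in \<open>simp add: lcb_reward_def\<close>)
  show ?thesis using am a ra r0 by (auto simp: is_arg_max_def)
qed

text \<open>An average of values at most \<open>r s a0\<close> is at most \<open>r s a0\<close>; the
  two-sided bound makes \<open>r s\<close> integrable under every policy.\<close>

lemma optimal_policy_constant:
  assumes "\<And>s a. s \<in> {1..S} \<Longrightarrow> a \<in> {1..A} \<Longrightarrow> 0 \<le> r s a \<and> r s a \<le> r s a0" "a0 \<in> {1..A}"
  shows "optimal_policy S A r (\<lambda>_. return_pmf a0)"
  unfolding optimal_policy_def
proof (intro conjI allI impI ballI)
  show "is_policy S A (\<lambda>_. return_pmf a0)" using assms by (simp add: is_policy_def)
  fix \<pi> s assume \<pi>: "is_policy S A \<pi>" and s: "s \<in> {1..S}"
  have AE: "AE a in measure_pmf (\<pi> s). 0 \<le> r s a \<and> r s a \<le> r s a0"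
    unfolding AE_measure_pmf_iff
  proof
    fix a assume "a \<in> set_pmf (\<pi> s)"
    then have "a \<in> {1..A}" using \<pi> s unfolding is_policy_def by blast
    with s show "0 \<le> r s a \<and> r s a \<le> r s a0" by (rule assms(1))
  qed
  then have "integrable (measure_pmf (\<pi> s)) (r s)"
    by (intro measure_pmf.integrable_const_bound[where B = "r s a0"]) auto
  then show "policy_value r \<pi> s \<le> policy_value r (\<lambda>_. return_pmf a0) s"
    unfolding policy_value_def using AE by (auto intro!: measure_pmf.integral_le_const)
qed

section \<open>The hard instance\<close>

text \<open>The bandit is fixed before \<open>n\<close>; only the sampling distribution varies with
  \<open>n\<close>, which allows the bad actions to be sampled with probability of order
  \<open>1 / n\<close>. \<open>V2\<close> stands for the variance estimate in the penalty.\<close>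

lemma lcb_hard_instance:
  fixes h :: "real \<Rightarrow> real \<Rightarrow> real" and V2 :: real
  assumes \<delta>: "0 < \<delta>" "\<delta> < 1" and cb: "cb > 0" and q: "q \<ge> 2" and \<sigma>: "\<sigma> > 0" and R: "R > 0"
    and h: "rating_model h q \<sigma> R" and V2: "V2 \<ge> 0"
  shows "\<exists>(c :: real) (S :: nat) (A :: nat) (r :: nat \<Rightarrow> nat \<Rightarrow> real) (\<rho> :: nat pmf).
    contextual_bandit S A R r \<rho> \<and>
    (\<forall>n :: nat. real n \<ge> c \<longrightarrow>
      (\<exists>(d :: (nat \<times> nat) pmf) (\<pi>s :: nat \<Rightarrow> nat pmf).
         set_pmf d \<subseteq> {1..S} \<times> {1..A} \<and>
         optimal_policy S A r \<pi>s \<and>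
         partial_coverage S A \<rho> \<pi>s d \<and>
         concentrability S A \<rho> \<pi>s d = 2 \<and>
         (\<forall>act. lcb_output (dataset_law h \<sigma> r d n) S A (penalty cb V2 S A \<delta>) n act \<longrightarrow>
            (\<integral>D. subopt \<rho> r \<pi>s (\<lambda>s. return_pmf (act D s)) \<partial>(dataset_law h \<sigma> r d n))
              \<ge> 1/4 * R)))"
proof -

  \<comment> \<open>Ratings of the rewards 0 and \<open>R\<close>\<close>
  interpret N: prob_space "noise \<sigma>" using \<sigma> by (rule prob_space_noise)
  have poly: "\<exists>p :: real poly. degree p = q \<and> h x = poly p" if "x \<in> {0..R}" for x
    using h that unfolding rating_model_def by (metis ext)
  obtain p0 where p0: "degree p0 = q" "h 0 = poly p0" using poly[of 0] R by auto
  obtain pR where pR: "h R = poly pR" using poly[of R] R by auto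
  \<comment> \<open>Reward 0 has mean rating 0, so the symmetry assumption holds for
    \<open>h 0\<close> without centring.\<close>
  have "mean_rating h \<sigma> 0 = 0" using h by (simp add: rating_model_def)
  moreover have "distr (noise \<sigma>) borel (\<lambda>e. - (h 0 e - mean_rating h \<sigma> 0)) =
        distr (noise \<sigma>) borel (\<lambda>e. h 0 e - mean_rating h \<sigma> 0)"
    using h R unfolding rating_model_def by (meson atLeastAtMost_iff less_imp_le order_refl)
  ultimately have sym: "distr (noise \<sigma>) borel (\<lambda>e. - poly p0 e) = distr (noise \<sigma>) borel (poly p0)"
    by (simp add: p0)
  have "mean_rating h \<sigma> ` {0..R} \<subseteq> {0..R}" using h by (simp add: rating_model_def)
  then have "mean_rating h \<sigma> R \<in> {0..R}" using R by (auto simp: image_subset_iff)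
  then have mean_R: "(\<integral>e. poly pR e \<partial>noise \<sigma>) \<le> R" by (simp add: mean_rating_def pR)

  \<comment> \<open>Thresholds and the number of bad actions\<close>
  define T where "T = R + 1"
  define C where "C = cb * sqrt V2"
  \<comment> \<open>\<open>T\<close> exceeds the mean rating of action 1, which is at most
    \<open>R\<close>, by at least 1; \<open>K\<close> is the second moment about \<open>T\<close>
    that enters Chebyshev's inequality.\<close>
  define K where "K = (\<integral>e. (poly pR e - T)\<^sup>2 \<partial>noise \<sigma>)"
  \<comment> \<open>The value 10 makes the collision probability, at most
    \<open>1 / (N * p)\<close>, no larger than 1/10.\<close>
  obtain N :: nat where N: "N \<ge> 1"
    "real N * measure (noise \<sigma>) {e. poly p0 e > T + C * sqrt (ln (real (N + 2) / \<delta>))} \<ge> 10"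
  proof (rule symmetric_poly_noise_tail_many[OF \<sigma> _ sym \<delta>(1), where C = C and T = T and B = 10])
    show "degree p0 \<ge> 2" using p0(1) q by simp
    show "C \<ge> 0" using cb V2 by (simp add: C_def)
  qed
  define A where "A = N + 2"
  define b where "b = penalty cb V2 1 A \<delta>"
  have b1: "b 1 = C * sqrt (ln (real A / \<delta>))"
    by (simp add: b_def penalty_def C_def real_sqrt_mult)
  have "real A / \<delta> \<ge> 1" using \<delta> by (simp add: A_def)
  then have b_nonneg: "b m \<ge> 0" for m
    unfolding b_def penalty_def using cb V2
    by (intro mult_nonneg_nonneg) (auto intro!: divide_nonneg_nonneg)
  define \<theta> where "\<theta> = T + b 1"
  define p where "p = measure (noise \<sigma>) {e. poly p0 e > \<theta>}"
  have Np: "real N * p \<ge> 10"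
    using N(2) unfolding p_def \<theta>_def b1 A_def .
  have p: "p > 0" using Np by (smt (verit) mult_nonneg_nonpos of_nat_0_le_iff)

  \<comment> \<open>The bandit: one state, one rewarding action\<close>
  define r where "r s a = (if s = 1 \<and> a = 1 then R else 0)" for s a :: nat
  define \<rho> :: "nat pmf" where "\<rho> = return_pmf 1"
  define \<pi>s :: "nat \<Rightarrow> nat pmf" where "\<pi>s = (\<lambda>_. return_pmf 1)"
  \<comment> \<open>Since \<open>r\<close> vanishes away from \<open>(1, 1)\<close>, also outside
    the ranges, every rating is one of two polynomials.\<close>
  have hr: "h (r s a) \<in> borel_measurable borel" for s a
    using p0(2) pR by (simp add: r_def)
  have bandit: "contextual_bandit 1 A R r \<rho>"
    using R by (simp add: contextual_bandit_def r_def \<rho>_def A_def)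
  have opt: "optimal_policy 1 A r \<pi>s"
    unfolding \<pi>s_def using R by (intro optimal_policy_constant) (auto simp: r_def A_def)
  have vis: "visitation \<rho> \<pi>s 1 a = (if a = 1 then 1 else 0)" for a
    by (simp add: visitation_def \<rho>_def \<pi>s_def pmf_return)

  \<comment> \<open>The sampling distribution for a given sample size\<close>
  have main: "\<exists>(d :: (nat \<times> nat) pmf) (\<pi>s :: nat \<Rightarrow> nat pmf).
         set_pmf d \<subseteq> {1..1} \<times> {1..A} \<and>
         optimal_policy 1 A r \<pi>s \<and>
         partial_coverage 1 A \<rho> \<pi>s d \<and>
         concentrability 1 A \<rho> \<pi>s d = 2 \<and>
         (\<forall>act. lcb_output (dataset_law h \<sigma> r d n) 1 A (penalty cb V2 1 A \<delta>) n act \<longrightarrow>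
            (\<integral>D. subopt \<rho> r \<pi>s (\<lambda>s. return_pmf (act D s)) \<partial>(dataset_law h \<sigma> r d n))
              \<ge> 1/4 * R)" if n: "real n \<ge> max 1 (max (20 * K) (2 / p))" for n
  proof -
    \<comment> \<open>Solves \<open>N * w * p = 1 / n\<close>: one sample is an extreme rating of a
      bad action with probability \<open>1 / n\<close>.\<close>
    define w where "w = 1 / (real N * p * real n)"
    \<comment> \<open>The bound \<open>2 / p\<close> makes the total mass
      \<open>N * w = 1 / (p * n)\<close> of the bad actions at most 1/2; \<open>20 * K\<close> makes
      the Chebyshev bound \<open>2 * K / n\<close> at most 1/10.\<close>
    have n1: "n \<ge> 1" "real n \<ge> 20 * K" "real n \<ge> 2 / p" using n by auto
    have Npn: "real N * p * real n > 0" using N(1) p n1(1) by (intro mult_pos_pos) auto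
    have pos: "real N > 0" "real n > 0" using N(1) n1(1) by auto
    have "p * real n \<ge> 2" using n1(3) p by (simp add: pos_divide_le_eq mult.commute)
    moreover have Nw: "real N * w = 1 / (p * real n)" using pos by (simp add: w_def)
    ultimately have "real N * w \<le> 1/2" unfolding Nw using p pos by (simp add: pos_divide_le_eq)
    moreover have "w \<ge> 0" using Npn by (simp add: w_def)
    ultimately have w: "w \<ge> 0" "real N * w \<le> 1/2" by blast+
    obtain d :: "(nat \<times> nat) pmf" where d: "set_pmf d \<subseteq> {1} \<times> {1..N+2}" "pmf d (1, 1) = 1/2"
        "\<And>a. a \<in> {2..N+1} \<Longrightarrow> pmf d (1, a) = w"
      using exists_sampling_pmf[OF w] by blast
    then have d1: "1 / pmf d (1, 1) = 2" "pmf d (1, 1) > 0" by (simp_all only: d(2), simp_all)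
    have cover: "partial_coverage 1 A \<rho> \<pi>s d"
      using d1 by (auto simp: partial_coverage_def vis simp del: One_nat_def split: if_splits)
    have conc: "concentrability 1 A \<rho> \<pi>s d = 2"
      unfolding concentrability_def
    proof (rule Max_eqI)
      let ?X = "{visitation \<rho> \<pi>s s a / pmf d (s, a) | s a.
            s \<in> {1..1} \<and> a \<in> {1..A} \<and> pmf d (s, a) > 0}"
      have "?X \<subseteq> (\<lambda>a. visitation \<rho> \<pi>s 1 a / pmf d (1, a)) ` {1..A}" by auto
      then show "finite ?X" by (rule finite_surj[rotated]) simp
      show "y \<le> 2" if "y \<in> ?X" for y
        using that d1 by (auto simp: vis simp del: One_nat_def split: if_splits)
      show "2 \<in> ?X"
        using d1 by (auto intro!: exI[of _ 1] simp: vis A_def simp del: One_nat_def)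
    qed

    \<comment> \<open>The law of the data set and of its samples\<close>
    define M where "M = rated_sample h \<sigma> r d"
    define P where "P = Pi\<^sub>M {1..n} (\<lambda>_. M)"
    interpret M: prob_space M unfolding M_def using hr \<sigma> by (rule prob_space_rated_sample)
    interpret P: prob_space P unfolding P_def by (intro prob_space_PiM) unfold_locales
    have sets_M [measurable_cong]: "sets M = sets (count_space UNIV \<Otimes>\<^sub>M (count_space UNIV \<Otimes>\<^sub>M borel))"
      by (simp add: M_def rated_sample_def)
    then have space_M: "space M = UNIV" by (simp add: sets_eq_imp_space_eq space_pair_measure)
    have law: "dataset_law h \<sigma> r d n = P" by (simp add: dataset_law_def P_def M_def)

    \<comment> \<open>An extreme rating of \<open>a\<close>, and below any sample of
      \<open>a\<close>: a second sample could dilute the extreme rating.\<close>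
    define U where "U a = {(s', a', x). s' = (1::nat) \<and> a' = (a::nat) \<and> x > \<theta>}" for a
    define W where "W a = {(s', a', x :: real). s' = (1::nat) \<and> a' = (a::nat)}" for a
    have at: "M.prob {(s', a', x). s' = 1 \<and> a' = a \<and> x \<in> B} =
        pmf d (1, a) * measure (noise \<sigma>) {e. h (r 1 a) e \<in> B}"
      if [measurable]: "B \<in> sets borel" for a B
    proof -
      have meas: "{e. h (r 1 a) e \<in> B} \<in> sets (noise \<sigma>)"
        using measurable_sets[OF hr[of 1 a] that] by (simp add: vimage_def)
      have ind: "(\<lambda>e. indicat_real B (h (r 1 a) e)) = indicator {e. h (r 1 a) e \<in> B}"
        by (auto simp: indicator_def)
      have int: "integrable (noise \<sigma>) (\<lambda>e. indicat_real B (h (r 1 a) e))"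
        unfolding ind using meas by (intro integrable_real_indicator) (auto simp: N.emeasure_eq_measure)
      have "{(s', a', x). s' = 1 \<and> a' = a \<and> x \<in> B} = {1} \<times> {a} \<times> B" by auto
      then have "{(s', a', x). s' = 1 \<and> a' = a \<and> x \<in> B} \<in> sets M"
        unfolding sets_M by (simp del: One_nat_def)
      then have "M.prob {(s', a', x). s' = 1 \<and> a' = a \<and> x \<in> B} =
          M.expectation (indicator {(s', a', x). s' = 1 \<and> a' = a \<and> x \<in> B})" by simp
      also have "\<dots> = M.expectation (\<lambda>(s', a', x). if s' = 1 \<and> a' = a then indicator B x else 0)"
        by (intro Bochner_Integration.integral_cong) (auto simp: indicator_def split: if_splits)
      also have "\<dots> = pmf d (1, a) * N.expectation (\<lambda>e. indicator B (h (r 1 a) e))"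
        unfolding M_def using hr \<sigma> _ int by (rule rated_sample_integral_at) simp
      finally show ?thesis unfolding ind using meas by simp
    qed
    have "U a = {1} \<times> {a} \<times> {\<theta><..}" "W a = {1} \<times> {a} \<times> UNIV" for a
      by (auto simp: U_def W_def)
    then have U_sets: "U a \<in> sets M" and W_sets: "W a \<in> sets M" for a
      unfolding sets_M by simp_all
    have U_prob: "M.prob (U a) = w * p" and W_prob: "M.prob (W a) = w" if "a \<in> {2..N+1}" for a
      using at[of "{\<theta><..}" a] at[of UNIV a] that d(3)[OF that]
      by (auto simp: U_def W_def r_def p0(2) p_def N.prob_space[simplified])

    \<comment> \<open>Three failure events\<close>
    define B where "B = (\<Union>a\<in>{2..N+1}. U a)"
    have B_sets: "B \<in> sets M" unfolding B_def using U_sets by auto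
    have "M.prob B = (\<Sum>a\<in>{2..N+1}. M.prob (U a))"
      unfolding B_def using U_sets
      by (intro M.finite_measure_finite_Union) (auto simp: disjoint_family_on_def U_def)
    also have "\<dots> = real N * (w * p)" using U_prob by simp
    also have "\<dots> = 1 / real n" using pos p by (simp add: w_def)
    finally have B_prob: "M.prob B = 1 / real n" .

    \<comment> \<open>First failure: no bad action receives an extreme rating.\<close>
    define E1 where "E1 = {D \<in> space P. \<forall>i\<in>{1..n}. D i \<notin> B}"
    have "P.prob E1 = (1 - 1 / real n) ^ n"
      using M.iid_avoid_prob[of "{1..n}" B] B_sets B_prob by (simp add: P_def E1_def)
    then have E1: "P.prob E1 \<le> 1/2" using one_minus_inverse_power_le_half[OF n1(1)] by simp

    \<comment> \<open>Second failure: a bad action with an extreme rating is sampled again. The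
      union bound is \<open>n\<^sup>2 * N * (w * p) * w = 1 / (N * p)\<close>.\<close>
    define E2 where "E2 = {D \<in> space P. \<exists>i\<in>{1..n}. \<exists>j\<in>{1..n}. i \<noteq> j \<and>
      (\<exists>a\<in>{2..N+1}. D i \<in> U a \<and> D j \<in> W a)}"
    have E2_sets: "E2 \<in> sets P"
      unfolding E2_def P_def using U_sets W_sets U_prob W_prob
      by (intro M.iid_collision_prob_le) auto
    have "P.prob E2 \<le> (real (card {1..n}))\<^sup>2 * (real (card {2..N+1}) * (w * p * w))"
      unfolding E2_def P_def using U_sets W_sets U_prob W_prob
      by (intro M.iid_collision_prob_le) auto
    also have "\<dots> = 1 / (real N * p)"
      using pos p by (simp add: w_def field_simps power2_eq_square)
    also have "\<dots> \<le> 1/10" using Np by (simp add: field_simps)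
    finally have E2: "P.prob E2 \<le> 1/10" .

    \<comment> \<open>Summing ratings shifted by \<open>T\<close> compares the average of action 1
      with \<open>T\<close> without conditioning on its random sample count. The mean of
      \<open>Y\<close> is at most -1/2: the gap 1 times the sampling probability 1/2.\<close>
    define Y where "Y = (\<lambda>(s', a', x). if s' = (1::nat) \<and> a' = (1::nat) then x - T else 0)"
    have Y_sq: "(Y z)\<^sup>2 = (case z of (s', a', x) \<Rightarrow> if s' = 1 \<and> a' = 1 then (x - T)\<^sup>2 else 0)" for z
      by (auto simp: Y_def split: prod.splits)
    have int1: "integrable (noise \<sigma>) (\<lambda>e. h (r 1 1) e - T)"
      using integrable_noise_poly[OF \<sigma>, of pR] by (simp add: r_def pR)
    have "(\<lambda>e. (h (r 1 1) e - T)\<^sup>2) = poly ((pR - [:T:])\<^sup>2)"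
      by (simp add: r_def pR fun_eq_iff)
    then have int2: "integrable (noise \<sigma>) (\<lambda>e. (h (r 1 1) e - T)\<^sup>2)"
      using integrable_noise_poly[OF \<sigma>] by simp
    have Y1: "integrable M Y" "M.expectation Y = 1/2 * (\<integral>e. h (r 1 1) e - T \<partial>noise \<sigma>)"
      using rated_sample_integral_at[where f = "\<lambda>x. x - T" and d = d and h = h and r = r and s = 1 and a = 1, OF hr \<sigma> _ int1] d(2)
      by (simp_all add: Y_def M_def)
    have Y2: "integrable M (\<lambda>z. (Y z)\<^sup>2)"
        "M.expectation (\<lambda>z. (Y z)\<^sup>2) = 1/2 * (\<integral>e. (h (r 1 1) e - T)\<^sup>2 \<partial>noise \<sigma>)"
      unfolding Y_sq
      using rated_sample_integral_at[where f = "\<lambda>x. (x - T)\<^sup>2" and d = d and h = h and r = r and s = 1 and a = 1, OF hr \<sigma> _ int2] d(2)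
      by (simp_all add: M_def)
    have EY: "M.expectation Y \<le> - (1/2)"
      using Y1(2) mean_R integrable_noise_poly[OF \<sigma>, of pR]
      by (simp add: r_def pR T_def N.prob_space[simplified])
    have EY2: "M.expectation (\<lambda>z. (Y z)\<^sup>2) = K / 2"
      using Y2(2) by (simp add: r_def pR K_def)
    define E3 where "E3 = {D \<in> space P. 0 \<le> (\<Sum>i\<in>{1..n}. Y (D i))}"
    have "P.prob E3 \<le> (K / 2) / (real n * (1/2)\<^sup>2)"
      using M.iid_sum_nonneg_prob_le[OF _ _ Y1(1) Y2(1) _ EY, of "{1..n}"] n1(1)
      by (simp add: E3_def P_def EY2)
    also have "\<dots> \<le> 1/10" using n1 by (simp add: field_simps)
    finally have E3: "P.prob E3 \<le> 1/10" .

    have [measurable]: "Y \<in> borel_measurable M" using Y1(1) by auto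
    have [measurable]: "B \<in> sets M" by (rule B_sets)
    have E_sets: "E1 \<in> sets P" "E3 \<in> sets P"
      unfolding E1_def E3_def P_def by measurable
    \<comment> \<open>The failures add up to at most 1/2 + 1/10 + 1/10, below 3/4.\<close>
    have "P.prob (E1 \<union> E2 \<union> E3) \<le> P.prob E1 + P.prob E2 + P.prob E3"
      using E_sets E2_sets
      by (smt (verit, best) measure_Un_le sets.Un)
    then have fail: "P.prob (E1 \<union> E2 \<union> E3) \<le> 3/4" using E1 E2 E3 by linarith

    \<comment> \<open>Suboptimality outside the failure events\<close>
    have result: "(\<integral>D. subopt \<rho> r \<pi>s (\<lambda>s. return_pmf (act D s)) \<partial>P) \<ge> 1/4 * R"
      if act: "lcb_output P 1 A b n act" for act
    proof -
      have [measurable]: "(\<lambda>D. act D 1) \<in> P \<rightarrow>\<^sub>M count_space UNIV"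
        and am: "\<And>D. D \<in> space P \<Longrightarrow> is_arg_max (lcb_reward b n D 1) (\<lambda>a. a \<in> {1..A}) (act D 1)"
        using act by (auto simp: lcb_output_def)
      define G where "G = {D \<in> space P. act D 1 \<noteq> 1}"
      have G: "G \<in> sets P" unfolding G_def by measurable
      have sub: "space P - (E1 \<union> E2 \<union> E3) \<subseteq> G"
      proof
        fix D assume D: "D \<in> space P - (E1 \<union> E2 \<union> E3)"
        then obtain i a where i: "i \<in> {1..n}" and a: "a \<in> {2..N+1}" and Di: "D i \<in> U a"
          by (auto simp: E1_def B_def)
        then obtain x where x: "D i = (1, a, x)" "x > T + b 1" by (auto simp: U_def \<theta>_def)
        have unique: "j = i" if "j \<in> {1..n}" "D j = (1, a, y)" for j y
        proof (rule ccontr)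
          assume "j \<noteq> i"
          moreover have "D j \<in> W a" using that by (simp add: W_def)
          ultimately have "i \<noteq> j \<and> (\<exists>a\<in>{2..N+1}. D i \<in> U a \<and> D j \<in> W a)"
            using a Di by (intro conjI bexI[of _ a]) simp_all
          then have "\<exists>j\<in>{1..n}. i \<noteq> j \<and> (\<exists>a\<in>{2..N+1}. D i \<in> U a \<and> D j \<in> W a)"
            using that(1) by (rule bexI)
          then have "\<exists>i\<in>{1..n}. \<exists>j\<in>{1..n}. i \<noteq> j \<and> (\<exists>a\<in>{2..N+1}. D i \<in> U a \<and> D j \<in> W a)"
            using i by (rule bexI)
          then have "D \<in> E2" unfolding E2_def using D by simp
          with D show False by simp
        qed
        have neg: "(\<Sum>j\<in>{1..n}. case D j of (s', a', y) \<Rightarrow> if s' = 1 \<and> a' = 1 then y - T else 0) \<le> 0"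
          using D unfolding E3_def Y_def by auto
        have "a \<in> {1..A}" "T \<ge> 0" "D \<in> space P" using a R D by (simp_all add: A_def T_def)
        then have "act D 1 \<noteq> 1"
          by (intro lcb_argmax_overestimated[where b = b and T = T and x = x and D = D and n = n and
                i = i and s = 1 and a = a and a' = 1 and B = "{1..A}"] i x unique b_nonneg neg am)
        then show "D \<in> G" using D by (simp add: G_def)
      qed
      have "1/4 \<le> P.prob (space P - (E1 \<union> E2 \<union> E3))"
        using fail E_sets E2_sets by (subst P.prob_compl) auto
      also have "\<dots> \<le> P.prob G" using sub G by (rule P.finite_measure_mono)
      finally have PG: "1/4 \<le> P.prob G" .
      \<comment> \<open>Every action other than 1 loses exactly \<open>R\<close>, so the
        suboptimality is \<open>R\<close> on \<open>G\<close> and 0 elsewhere.\<close>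
      have "(\<integral>D. subopt \<rho> r \<pi>s (\<lambda>s. return_pmf (act D s)) \<partial>P) = (\<integral>D. R * indicator G D \<partial>P)"
        by (intro Bochner_Integration.integral_cong)
          (auto simp: subopt_def \<rho>_def \<pi>s_def policy_value_def r_def G_def indicator_def)
      also have "\<dots> = P.prob G * R" using G by simp
      also have "\<dots> \<ge> 1/4 * R" using PG R by (intro mult_right_mono) auto
      finally show ?thesis .
    qed
    have "set_pmf d \<subseteq> {1..1} \<times> {1..A}" using d(1) by (auto simp: A_def)
    moreover have "\<forall>act. lcb_output (dataset_law h \<sigma> r d n) 1 A (penalty cb V2 1 A \<delta>) n act \<longrightarrow>
            (\<integral>D. subopt \<rho> r \<pi>s (\<lambda>s. return_pmf (act D s)) \<partial>(dataset_law h \<sigma> r d n)) \<ge> 1/4 * R"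
      unfolding law b_def[symmetric] using result by blast
    ultimately show ?thesis using opt cover conc by (intro exI conjI)
  qed
  show ?thesis
    by (rule exI[of _ "max 1 (max (20 * K) (2 / p))"], rule exI[of _ 1], rule exI[of _ A],
        rule exI[of _ r], rule exI[of _ \<rho>], rule conjI[OF bandit]) (intro allI impI main)
qed

theorem theorem1:
  shows "\<exists>c0 :: real. c0 > 0 \<and>
    (\<forall>(h :: real \<Rightarrow> real \<Rightarrow> real) (V :: real \<Rightarrow> real \<Rightarrow> real).
     \<exists>c :: real \<Rightarrow> real \<Rightarrow> real \<Rightarrow> nat \<Rightarrow> real \<Rightarrow> real \<Rightarrow> real.
     \<forall>(\<delta> :: real) (cb :: real) (cV :: real) (q :: nat) (\<sigma> :: real) (R :: real).
       0 < \<delta> \<and> \<delta> < 1 \<and> cb > 0 \<and> cV > 0 \<and> q \<ge> 2 \<and> \<sigma> > 0 \<and> R > 0 \<and>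
       rating_model h q \<sigma> R \<and> rating_variance_bound h \<sigma> R ((V R \<sigma>)\<^sup>2) \<longrightarrow>
       (\<exists>(S :: nat) (A :: nat) (r :: nat \<Rightarrow> nat \<Rightarrow> real) (\<rho> :: nat pmf).
          contextual_bandit S A R r \<rho> \<and>
          (\<forall>n :: nat. real n \<ge> c \<delta> cb cV q \<sigma> R \<longrightarrow>
            (\<exists>(d :: (nat \<times> nat) pmf) (\<pi>s :: nat \<Rightarrow> nat pmf).
               set_pmf d \<subseteq> {1..S} \<times> {1..A} \<and>
               optimal_policy S A r \<pi>s \<and>
               partial_coverage S A \<rho> \<pi>s d \<and>
               concentrability S A \<rho> \<pi>s d = 2 \<and>
               (\<forall>act. lcb_output (dataset_law h \<sigma> r d n) S A
                        (penalty cb (cV * (V R \<sigma>)\<^sup>2) S A \<delta>) n act \<longrightarrow>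
                  (\<integral>D. subopt \<rho> r \<pi>s (\<lambda>s. return_pmf (act D s)) \<partial>(dataset_law h \<sigma> r d n))
                    \<ge> c0 * R)))))"
  (is "\<exists>c0. c0 > 0 \<and> (\<forall>h V. \<exists>c. \<forall>\<delta> cb cV q \<sigma> R. ?hyp h V \<delta> cb cV q \<sigma> R \<longrightarrow>
    ?concl c0 h V \<delta> cb cV q \<sigma> R (c \<delta> cb cV q \<sigma> R))")
proof (intro exI[of _ "1/4 :: real"] conjI allI)
  fix h V
  have ex: "\<exists>c. ?concl (1/4) h V \<delta> cb cV q \<sigma> R c" if "?hyp h V \<delta> cb cV q \<sigma> R" for \<delta> cb cV q \<sigma> R
    by (rule lcb_hard_instance[where q = q]) (use that in auto)
  \<comment> \<open>The sample-size bound must be one function fixed before the parameters, so the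
    bounds from the hard instances are collected by choice. It may depend on \<open>h\<close> and
    \<open>V\<close>, which are already fixed.\<close>
  define c where "c = (\<lambda>\<delta> cb cV q \<sigma> R. SOME c. ?concl (1/4) h V \<delta> cb cV q \<sigma> R c)"
  show "\<exists>c. \<forall>\<delta> cb cV q \<sigma> R. ?hyp h V \<delta> cb cV q \<sigma> R \<longrightarrow>
      ?concl (1/4) h V \<delta> cb cV q \<sigma> R (c \<delta> cb cV q \<sigma> R)"
  proof (rule exI[of _ c], intro allI impI)
    fix \<delta> cb cV q \<sigma> R assume "?hyp h V \<delta> cb cV q \<sigma> R"
    from ex[OF this] show "?concl (1/4) h V \<delta> cb cV q \<sigma> R (c \<delta> cb cV q \<sigma> R)"
      unfolding c_def by (rule someI_ex)
  qed
qed simp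

end
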